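(* Let $E$ be a real normed linear space. If $\mathbb{A}$ is the global attractor of a homeomorphism $F:E\to E$, then $\mathbb{A}$ has trivial shape.
   Context: A set $\mathbb{A}$ is a global attractor for a continuous map $F:E\to E$ if $\mathbb{A}$ is compact, $F(\mathbb{A})=\mathbb{A}$, and for every bounded $B\subset E$, $\operatorname{dist}(F^n(B),\mathbb{A})\to0$ as $n\to\infty$, where $\operatorname{dist}(A,B)=\sup_{a\in A}\inf_{b\in B}\|a-b\|$. For $A\subset B$, $A$ is contractible in $B$ if there is a continuous map $G:A\times[0,1]\to B$ with $G(p,0)=p$ for all $p\in A$ and $G(\cdot,1)$ constant. A compact subset $X$ of $E$ has trivial shape if for every neighbourhood $U$ of $X$ in $E$, $X$ is contractible in $U$. *)

theory Defs
  imports "HOL-Analysis.Analysis"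
begin

text \<open>
  The semidistance is \<^typ>\<open>ennreal\<close>-valued, so that suprema and infima have their usual meaning
  without side conditions: the image of a bounded set under a continuous map need not be bounded
  in infinite dimension, the semidistance from the empty set is 0, and the semidistance from a
  nonempty set to the empty set is infinite (hence a global attractor is never empty).
\<close>

definition semidist :: "'a::real_normed_vector set \<Rightarrow> 'a set \<Rightarrow> ennreal" where
  "semidist A B = (SUP a\<in>A. INF b\<in>B. ennreal (norm (a - b)))"

definition global_attractor :: "('a::real_normed_vector \<Rightarrow> 'a) \<Rightarrow> 'a set \<Rightarrow> bool" where
  "global_attractor F A \<longleftrightarrow>
     continuous_on UNIV F \<and> compact A \<and> F ` A = A \<and>
     (\<forall>B. bounded B \<longrightarrow> (\<lambda>n. semidist ((F ^^ n) ` B) A) \<longlonglongrightarrow> 0)"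

definition contractible_in :: "'a::topological_space set \<Rightarrow> 'a set \<Rightarrow> bool" where
  "contractible_in A B \<longleftrightarrow>
     A \<subseteq> B \<and>
     (\<exists>G :: 'a \<times> real \<Rightarrow> 'a.
        continuous_on (A \<times> {0..1}) G \<and> G ` (A \<times> {0..1}) \<subseteq> B \<and>
        (\<forall>p\<in>A. G (p, 0) = p) \<and> (\<lambda>p. G (p, 1)) constant_on A)"

text \<open>Neighbourhoods of a set need not be open; they contain the set in their interior.\<close>

definition trivial_shape :: "'a::real_normed_vector set \<Rightarrow> bool" where
  "trivial_shape X \<longleftrightarrow>
     compact X \<and> (\<forall>U. X \<subseteq> interior U \<longrightarrow> contractible_in X U)"

end

theory Submission
  imports Defs
begin

text \<open>
  Let \<open>U\<close> be a neighbourhood of the attractor and \<open>B\<close> a ball around the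
  origin that contains it. For large \<open>n\<close> the iterate \<open>F ^^ n\<close>
  maps \<open>B\<close> into \<open>U\<close>, and \<open>F ^^ n\<close> restricts to a homeomorphism of the attractor. Hence the
  straight-line contraction of the attractor to the origin inside \<open>B\<close>, conjugated by \<open>F ^^ n\<close>,
  contracts the attractor inside \<open>U\<close>.
\<close>

lemma continuous_on_funpow:
  fixes f :: "'a::topological_space \<Rightarrow> 'a"
  assumes "continuous_on UNIV f"
  shows "continuous_on UNIV (f ^^ n)"
proof (induction n)
  case (Suc n)
  then show ?case
    unfolding funpow.simps by (rule continuous_on_compose[OF _ continuous_on_subset[OF assms subset_UNIV]])
qed (simp add: id_def)

text \<open>Strictness is what yields a point: an infimum strictly below \<open>e\<close> is
  undercut by some element of \<open>A\<close>, whether or not it is attained.\<close>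

lemma semidist_less_imp_near:
  assumes "semidist S A < ennreal e" "x \<in> S"
  shows "\<exists>a\<in>A. dist a x < e"
proof -
  have "(INF b\<in>A. ennreal (norm (x - b))) \<le> semidist S A"
    unfolding semidist_def using assms(2) by (intro SUP_upper)
  then obtain a where "a \<in> A" "ennreal (norm (x - a)) < ennreal e"
    using assms(1) by (auto dest!: order_le_less_trans simp: INF_less_iff)
  then show ?thesis
    by (auto simp: ennreal_less_iff dist_norm norm_minus_commute)
qed

theorem corollary3p3:
  fixes F :: "'a::real_normed_vector \<Rightarrow> 'a" and A :: "'a set"
  assumes "\<exists>G. homeomorphism UNIV UNIV F G"
    and "global_attractor F A"
  shows "trivial_shape A"
proof -
  obtain G where "homeomorphism UNIV UNIV F G"
    using assms(1) by blast
  then have contF: "continuous_on UNIV F" and contG: "continuous_on UNIV G"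
    and GF: "\<And>x. G (F x) = x" and FG: "\<And>x. F (G x) = x"
    by (auto simp: homeomorphism_def)
  have A: "compact A" "F ` A = A"
    and attr: "\<And>B. bounded B \<Longrightarrow> (\<lambda>n. semidist ((F ^^ n) ` B) A) \<longlonglongrightarrow> 0"
    using assms(2) by (auto simp: global_attractor_def)
  have FGn: "(F ^^ n) ((G ^^ n) x) = x" for n x
  proof (induction n arbitrary: x)
    case (Suc n)
    \<comment> \<open>The outermost \<open>F\<close> and the innermost \<open>G\<close> are split
      off, so the induction hypothesis is needed at \<open>G x\<close>.\<close>
    have "(F ^^ Suc n) ((G ^^ Suc n) x) = F ((F ^^ n) ((G ^^ n) (G x)))"
      by (simp add: funpow_swap1)
    also have "\<dots> = x" by (simp add: Suc FG)
    finally show ?case .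
  qed simp
  \<comment> \<open>Invariance gives \<open>x = F y\<close> with \<open>y\<close> in
    \<open>A\<close>, and then \<open>G x = y\<close>.\<close>
  have "G x \<in> A" if "x \<in> A" for x
    using that A(2) GF by (metis imageE)
  then have GnA: "(G ^^ n) x \<in> A" if "x \<in> A" for n x
    using that by (induction n) auto
  have "contractible_in A U" if U: "A \<subseteq> interior U" for U
  proof -
    \<comment> \<open>Compactness makes one radius \<open>e\<close> work for all points of
      \<open>A\<close>, matching the uniform bound that attraction provides.\<close>
    obtain e where "e > 0" and e: "(\<Union>a\<in>A. ball a e) \<subseteq> interior U"
      using compact_subset_open_imp_ball_epsilon_subset[OF A(1) open_interior U] by blast
    obtain R where R: "\<And>x. x \<in> A \<Longrightarrow> norm x \<le> R"
      using compact_imp_bounded[OF A(1)] by (auto simp: bounded_iff)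
    have "eventually (\<lambda>n. semidist ((F ^^ n) ` cball 0 R) A < ennreal e) sequentially"
      using order_tendstoD(2)[OF attr[OF bounded_cball]] \<open>e > 0\<close> by simp
    then obtain n where n: "semidist ((F ^^ n) ` cball 0 R) A < ennreal e"
      by (auto simp: eventually_sequentially)
    have inU: "(F ^^ n) x \<in> U" if "norm x \<le> R" for x
    proof -
      have "(F ^^ n) x \<in> (F ^^ n) ` cball 0 R"
        using that by (intro imageI) simp
      then obtain a where "a \<in> A" "dist a ((F ^^ n) x) < e"
        using semidist_less_imp_near[OF n] by blast
      then have "(F ^^ n) x \<in> interior U"
        by (intro subsetD[OF e] UN_I[of a]) auto
      then show ?thesis using interior_subset by blast
    qed
    define H where "H = (\<lambda>(p, t). (F ^^ n) ((1 - t) *\<^sub>R (G ^^ n) p))"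
    have "continuous_on (A \<times> {0..1}) H"
      unfolding H_def case_prod_unfold
      by (intro continuous_intros continuous_on_compose2[OF continuous_on_funpow[OF contF]]
          continuous_on_compose2[OF continuous_on_funpow[OF contG]]) auto
    moreover have "H (p, t) \<in> U" if "p \<in> A" "t \<in> {0..1}" for p t
    proof -
      \<comment> \<open>Shrinking towards the origin never leaves the ball of radius
        \<open>R\<close>, which contains \<open>(G ^^ n) p\<close> because that point is in
        \<open>A\<close>.\<close>
      have "norm ((1 - t) *\<^sub>R (G ^^ n) p) \<le> norm ((G ^^ n) p)"
        using that(2) by (simp add: mult_left_le_one_le)
      then show ?thesis
        using R[OF GnA[OF that(1), of n]] by (auto simp: H_def intro: inU)
    qed
    moreover have "H (p, 0) = p" for p
      by (simp add: H_def FGn)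
    \<comment> \<open>The constant value is \<open>(F ^^ n) 0\<close>.\<close>
    moreover have "(\<lambda>p. H (p, 1)) constant_on A"
      by (auto simp: H_def constant_on_def)
    ultimately show ?thesis
      using subset_trans[OF U interior_subset] unfolding contractible_in_def
      by (intro conjI exI[of _ H]) auto
  qed
  then show ?thesis
    using A(1) by (simp add: trivial_shape_def)
qed

end
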